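(* Let $F$ be a pythagorean field with a non-archimedean ordering $\leqslant$. Then there exists a matrix $A\in M_n(F)$ with $A\neq\pm I$, $A^TA=I$ and $\det A=1$ such that $\|I-A\|$ is infinitely small.
   Context: A field is pythagorean if every sum of squares in it is again a square. An ordering $\leqslant$ of $F$ (compatible with the field operations) is non-archimedean if there is an element of $F$ larger than every positive integer; equivalently, if there is a positive element of $F$ smaller than $1/m$ for every positive integer $m$. An element $x\in F$ is infinitely small if $|x|<1/m$ for every positive integer $m$, where $|\cdot|$ is the absolute value with respect to $\leqslant$. $M_n(F)$ denotes the ring of $n\times n$ matrices with entries in $F$, $I$ is the identity matrix in it, and $A^T$ is the transpose of $A$. For a matrix $A$ with entries in $F$, the Frobenius norm $\|A\|\in F$ is the absolute value of the square root of the sum of the squares of the entries of $A$; this square root exists in $F$ since $F$ is pythagorean.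
   Formalization: The size n, left unspecified in the statement, is taken to be any integer n ≥ 2; for n = 1 the claim fails, since det A = 1 forces A = I. *)

theory Defs
  imports "Jordan_Normal_Form.Determinant"
begin

definition pythagorean_field :: "'a::field itself \<Rightarrow> bool" where
  "pythagorean_field _ \<longleftrightarrow> (\<forall>xs :: 'a list. \<exists>y. y\<^sup>2 = (\<Sum>x\<leftarrow>xs. x\<^sup>2))"

definition nonarchimedean_ordering :: "'a::linordered_field itself \<Rightarrow> bool" where
  "nonarchimedean_ordering _ \<longleftrightarrow> (\<exists>x :: 'a. \<forall>m::nat. m > 0 \<longrightarrow> of_nat m < x)"

definition infinitely_small :: "'a::linordered_field \<Rightarrow> bool" where
  "infinitely_small x \<longleftrightarrow> (\<forall>m::nat. m > 0 \<longrightarrow> \<bar>x\<bar> < 1 / of_nat m)"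

definition sum_squares_entries :: "'a::linordered_field mat \<Rightarrow> 'a" where
  "sum_squares_entries A = (\<Sum>i<dim_row A. \<Sum>j<dim_col A. (A $$ (i, j))\<^sup>2)"

text \<open>The two square roots of an element differ only in sign, so the absolute value does not
  depend on which one is chosen. A square root exists whenever the field is pythagorean; this
  is \<open>frobenius_norm_power2\<close> below. Over other fields the value may be meaningless.\<close>

definition frobenius_norm :: "'a::linordered_field mat \<Rightarrow> 'a" where
  "frobenius_norm A = \<bar>SOME s. s\<^sup>2 = sum_squares_entries A\<bar>"

lemma frobenius_norm_nonneg: "0 \<le> frobenius_norm A"
  by (simp add: frobenius_norm_def)

lemma sum_list_sum_upt: "(\<Sum>i\<leftarrow>[0..<n]. f i) = (\<Sum>i<n. f i)"
  by (simp add: interv_sum_list_conv_sum_set_nat atLeast0LessThan)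

lemma sum_squares_entries_as_list:
  "sum_squares_entries A =
     (\<Sum>x\<leftarrow>concat (map (\<lambda>i. map (\<lambda>j. A $$ (i, j)) [0..<dim_col A]) [0..<dim_row A]). x\<^sup>2)"
proof -
  have "(\<Sum>x\<leftarrow>concat (map (\<lambda>i. map (\<lambda>j. A $$ (i, j)) [0..<m]) is). x\<^sup>2) =
        (\<Sum>i\<leftarrow>is. \<Sum>j<m. (A $$ (i, j))\<^sup>2)" for m "is"
    by (induction "is") (simp_all add: sum_list_sum_upt comp_def)
  then show ?thesis
    by (simp add: sum_squares_entries_def sum_list_sum_upt)
qed

lemma frobenius_norm_power2:
  fixes A :: "'a::linordered_field mat"
  assumes "pythagorean_field TYPE('a)"
  shows "(frobenius_norm A)\<^sup>2 = sum_squares_entries A"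
proof -
  have "\<exists>s. s\<^sup>2 = sum_squares_entries A"
    using assms unfolding pythagorean_field_def sum_squares_entries_as_list by blast
  then show ?thesis
    unfolding frobenius_norm_def power2_abs by (rule someI_ex)
qed

end

(* The matrix is a plane rotation through an infinitely small angle, extended by the identity.
   The rational parametrisation c = (1 - e^2)/(1 + e^2), s = 2e/(1 + e^2) of the unit circle
   puts its entries in F, and the squared Frobenius distance to the identity is
   2 (1 - c)^2 + 2 s^2 = 8 e^2/(1 + e^2) < (3e)^2. *)
theory Submission
  imports Defs
begin

definition rotation_mat2 :: "'a::comm_ring_1 \<Rightarrow> 'a \<Rightarrow> 'a mat" where
  "rotation_mat2 c s = mat 2 2 (\<lambda>(i, j). if i = j then c else if i < j then - s else s)"

text \<open>The size is written as \<open>2 + k\<close> and the matrix as a block diagonal one, so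
  that transpose, product and determinant reduce to the 2 x 2 block.\<close>

definition plane_rotation_mat :: "nat \<Rightarrow> 'a::comm_ring_1 \<Rightarrow> 'a \<Rightarrow> 'a mat" where
  "plane_rotation_mat k c s =
     four_block_mat (rotation_mat2 c s) (0\<^sub>m 2 k) (0\<^sub>m k 2) (1\<^sub>m k)"

lemma rotation_mat2_carrier: "rotation_mat2 c s \<in> carrier_mat 2 2"
  by (simp add: rotation_mat2_def)

lemma plane_rotation_mat_carrier: "plane_rotation_mat k c s \<in> carrier_mat (2 + k) (2 + k)"
  unfolding plane_rotation_mat_def
  by (rule four_block_carrier_mat[OF rotation_mat2_carrier one_carrier_mat])

lemma transpose_rotation_mat2_mult:
  assumes "c\<^sup>2 + s\<^sup>2 = 1"
  shows "transpose_mat (rotation_mat2 c s) * rotation_mat2 c s = 1\<^sub>m 2"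
proof (rule eq_matI)
  fix i j :: nat
  assume "i < dim_row (1\<^sub>m 2 :: 'a mat)" "j < dim_col (1\<^sub>m 2 :: 'a mat)"
  then have "i = 0 \<or> i = 1" "j = 0 \<or> j = 1"
    by auto
  then show "(transpose_mat (rotation_mat2 c s) * rotation_mat2 c s) $$ (i, j) = 1\<^sub>m 2 $$ (i, j)"
    using assms
    by (auto simp: rotation_mat2_def scalar_prod_def numeral_2_eq_2 algebra_simps)
qed (simp_all add: rotation_mat2_def)

lemma det_rotation_mat2: "det (rotation_mat2 c s) = c\<^sup>2 + s\<^sup>2"
  by (subst laplace_expansion_row[OF rotation_mat2_carrier, of 0])
    (simp_all add: rotation_mat2_def lessThan_Suc numeral_2_eq_2 cofactor_def det_single
      mat_delete_def)

lemma transpose_plane_rotation_mat_mult: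
  assumes "c\<^sup>2 + s\<^sup>2 = 1"
  shows "transpose_mat (plane_rotation_mat k c s) * plane_rotation_mat k c s = 1\<^sub>m (2 + k)"
proof -
  note R = rotation_mat2_carrier[of c s]
  have "transpose_mat (plane_rotation_mat k c s) =
      four_block_mat (transpose_mat (rotation_mat2 c s)) (0\<^sub>m 2 k) (0\<^sub>m k 2) (1\<^sub>m k)"
    unfolding plane_rotation_mat_def
    by (subst transpose_four_block_mat[OF R zero_carrier_mat zero_carrier_mat one_carrier_mat])
      simp
  then show ?thesis
    unfolding plane_rotation_mat_def
    using R transpose_rotation_mat2_mult[OF assms]
    \<comment> \<open>The block dimensions are instantiated by hand: they occur only in the carrier
      premises of the rule, not in the equation to be rewritten.\<close>
    by (simp add: mult_four_block_mat[of _ 2 2 _ k _ k _ _ 2 _ k])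
qed

lemma det_plane_rotation_mat:
  "det (plane_rotation_mat k c s :: 'a::idom mat) = c\<^sup>2 + s\<^sup>2"
  unfolding plane_rotation_mat_def
  by (subst det_four_block_mat_lower_left_zero[OF rotation_mat2_carrier zero_carrier_mat refl
        one_carrier_mat])
    (simp add: det_rotation_mat2)

text \<open>Both the identity and its negative vanish at \<open>(0, 1)\<close>, so this one entry
  separates the rotation from both once \<open>s\<close> is nonzero.\<close>

lemma plane_rotation_mat_entry_01: "plane_rotation_mat k c s $$ (0, 1) = - s"
  by (simp add: plane_rotation_mat_def rotation_mat2_def)

text \<open>The identity blocks cancel, so only the top left block of the difference survives:
  \<open>1 - c\<close> twice on its diagonal, \<open>s\<close> and \<open>- s\<close> off
  it.\<close>

lemma sum_squares_entries_one_minus_plane_rotation_mat: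
  "sum_squares_entries (1\<^sub>m (2 + k) - plane_rotation_mat k c s) = 2 * (1 - c)\<^sup>2 + 2 * s\<^sup>2"
proof -
  define N where "N = 2 + k"
  define D where "D = 1\<^sub>m N - plane_rotation_mat k c s"
  have entry: "D $$ (i, j) =
      (if i < 2 \<and> j < 2 then if i = j then 1 - c else if i < j then s else - s else 0)"
    if "i < N" "j < N" for i j
    using that by (auto simp: D_def N_def plane_rotation_mat_def rotation_mat2_def)
  have N: "{..<2} \<subseteq> {..<N}"
    by (simp add: N_def)
  have "sum_squares_entries D = (\<Sum>i<N. \<Sum>j<N. (D $$ (i, j))\<^sup>2)"
    using plane_rotation_mat_carrier[of k c s]
    by (simp add: sum_squares_entries_def D_def N_def)
  also have "\<dots> = (\<Sum>i<2. \<Sum>j<N. (D $$ (i, j))\<^sup>2)"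
    using N by (intro sum.mono_neutral_right) (auto simp: entry)
  also have "\<dots> = (\<Sum>i<2. \<Sum>j<2. (D $$ (i, j))\<^sup>2)"
    using N by (intro sum.cong refl sum.mono_neutral_right) (auto simp: entry)
  also have "\<dots> = 2 * (1 - c)\<^sup>2 + 2 * s\<^sup>2"
    by (simp add: numeral_2_eq_2 lessThan_Suc entry N_def)
  finally show ?thesis
    unfolding D_def N_def .
qed

text \<open>The witness is the reciprocal of an element above every positive integer.\<close>

lemma nonarchimedean_ordering_infinitesimal:
  assumes "nonarchimedean_ordering TYPE('a::linordered_field)"
  obtains e :: "'a::linordered_field" where "e > 0" "\<And>m::nat. m > 0 \<Longrightarrow> e < 1 / of_nat m"
proof -
  obtain x :: 'a where x: "\<And>m::nat. m > 0 \<Longrightarrow> of_nat m < x"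
    using assms by (auto simp: nonarchimedean_ordering_def)
  have "x > 0"
    using x[of 1] by simp
  moreover have "1 / x < 1 / of_nat m" if "m > 0" for m :: nat
    using x[OF that] that by (simp add: frac_less2)
  ultimately show ?thesis
    by (intro that[of "1 / x"]) auto
qed

text \<open>The bound \<open>n \<ge> 2\<close> excludes degenerate sizes: for \<open>n = 1\<close>
  orthogonality forces the matrix to be the identity or its negative, and for \<open>n = 0\<close>
  there is only one matrix.\<close>

theorem proposition3p3:
  fixes n :: nat
  assumes "pythagorean_field TYPE('a::linordered_field)"
    and "nonarchimedean_ordering TYPE('a)"
    and "n \<ge> 2"
  shows "\<exists>A :: 'a mat. A \<in> carrier_mat n n \<and> A \<noteq> 1\<^sub>m n \<and> A \<noteq> - 1\<^sub>m n \<and>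
    transpose_mat A * A = 1\<^sub>m n \<and> det A = 1 \<and> infinitely_small (frobenius_norm (1\<^sub>m n - A))"
proof -
  obtain e :: 'a where e: "e > 0" "\<And>m::nat. m > 0 \<Longrightarrow> e < 1 / of_nat m"
    using nonarchimedean_ordering_infinitesimal[OF assms(2)] by blast
  define d where "d = 1 + e\<^sup>2"
  define c where "c = (1 - e\<^sup>2) / d"
  define s where "s = 2 * e / d"
  obtain k where n: "n = 2 + k"
    using assms(3) le_Suc_ex by blast
  define A where "A = plane_rotation_mat k c s"
  \<comment> \<open>The denominator cannot vanish, being a sum of two squares, one of them
    \<open>1\<close>.\<close>
  have d: "d \<ge> 1" "d \<noteq> 0"
    unfolding d_def by (simp, metis less_numeral_extra(3) sum_power2_gt_zero_iff one_power2 zero_neq_one)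
  have "(1 - e\<^sup>2)\<^sup>2 + (2 * e)\<^sup>2 = d\<^sup>2"
    by (simp add: d_def power2_eq_square algebra_simps)
  then have cs: "c\<^sup>2 + s\<^sup>2 = 1"
    using d(2) by (simp add: c_def s_def power_divide flip: add_divide_distrib)
  have "s \<noteq> 0"
    using e(1) d(2) by (simp add: s_def)
  then have "A $$ (0, 1) \<noteq> 1\<^sub>m n $$ (0, 1)" "A $$ (0, 1) \<noteq> (- 1\<^sub>m n) $$ (0, 1)"
    using plane_rotation_mat_entry_01[of k c s] by (simp_all add: A_def n)
  then have "A \<noteq> 1\<^sub>m n" "A \<noteq> - 1\<^sub>m n"
    by metis+
  moreover have "infinitely_small (frobenius_norm (1\<^sub>m n - A))"
    unfolding infinitely_small_def
  proof (intro allI impI)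
    fix m :: nat
    assume m: "m > 0"
    have "1 - c = 2 * e\<^sup>2 / d"
      using d(2) by (simp add: c_def d_def field_simps)
    \<comment> \<open>On the unit circle the quadratic terms add up to \<open>2\<close>, which
      leaves an expression linear in \<open>c\<close>.\<close>
    moreover have "2 * (1 - c)\<^sup>2 + 2 * s\<^sup>2 = 4 * (1 - c)"
      using cs by (simp add: power2_eq_square algebra_simps)
    ultimately have "(frobenius_norm (1\<^sub>m n - A))\<^sup>2 = 8 * e\<^sup>2 / d"
      \<comment> \<open>Here the pythagorean hypothesis enters: it makes the square of the norm
        equal to the sum of squares of the entries.\<close>
      unfolding n A_def frobenius_norm_power2[OF assms(1)]
        sum_squares_entries_one_minus_plane_rotation_mat by simp
    also have "\<dots> \<le> 8 * e\<^sup>2 / 1"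
      using d(1) by (intro divide_left_mono) auto
    \<comment> \<open>Rounding 8 up to the perfect square 9 gives a bound whose root is simply
      \<open>3 * e\<close>.\<close>
    also have "\<dots> \<le> (3 * e)\<^sup>2"
      by (simp add: power_mult_distrib)
    finally have "frobenius_norm (1\<^sub>m n - A) \<le> 3 * e"
      by (rule power2_le_imp_le) (use e(1) in simp)
    also have "\<dots> < 1 / of_nat m"
      \<comment> \<open>Taking the bound on \<open>e\<close> at \<open>3 * m\<close> instead of
        \<open>m\<close> absorbs the factor 3.\<close>
      using e(2)[of "3 * m"] m by (simp add: field_simps)
    finally show "\<bar>frobenius_norm (1\<^sub>m n - A)\<bar> < 1 / of_nat m"
      by (simp add: frobenius_norm_nonneg)
  qed
  ultimately show ?thesis
    using plane_rotation_mat_carrier[of k c s] transpose_plane_rotation_mat_mult[OF cs, of k]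
      det_plane_rotation_mat[of k c s] cs
    by (intro exI[of _ A]) (simp add: A_def n)
qed

end
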